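(* Let $\mathbb{H}_1,\mathbb{H}_2$ be real Hilbert spaces such that $\dim(\mathbb{H}_1)<\infty$. Let $T\in S_{\mathbb{L}(\mathbb{H}_1,\mathbb{H}_2)}$. Then there exists $\epsilon_0>0$ such that for any $0<\epsilon<\epsilon_0$, if $A_\epsilon$ is a uniform $\epsilon$-BPB approximation of $T$, then the following conditions hold: (i) $\dim(H_0)=\dim(H)$, where $M_T=S_{H_0}$ and $M_{A_\epsilon}=S_H$ for some subspaces $H_0,H$ of $\mathbb{H}_1$; (ii) for any $\epsilon_1,\epsilon_2>0$ with $\epsilon_1^2+\epsilon_2^2>2\epsilon^2$, either $\|(T-A_\epsilon)|_{H_0}\|<\epsilon_1$ or $\|(T-A_\epsilon)|_{H_0^\perp}\|<\epsilon_2$; (iii) there exists $\delta=\delta(\epsilon)>0$ such that $M_T(\delta)\subseteq\bigcup_{x\in M_{A_\epsilon}}B(x,\epsilon)$.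
   Context: $\mathbb{L}(\mathbb{H}_1,\mathbb{H}_2)$ is the space of bounded linear operators with the operator norm; $S_Z$ is the unit sphere of a normed space $Z$; $B(x,r)$ is the open ball with center $x$ and radius $r$. For an operator $A$ and $\delta>0$, $M_A=\{x\in S_{\mathbb{H}_1}:\|Ax\|=\|A\|\}$ and $M_A(\delta)=\{x\in S_{\mathbb{H}_1}:\|Ax\|>\|A\|-\delta\}$. It is a known fact that for an operator between Hilbert spaces $M_A$ is either empty or the unit sphere of a subspace of the domain. For $T\in S_{\mathbb{L}(\mathbb{H}_1,\mathbb{H}_2)}$ and $\epsilon>0$, an operator $A\in S_{\mathbb{L}(\mathbb{H}_1,\mathbb{H}_2)}$ is a uniform $\epsilon$-BPB approximation of $T$ if $\|T-A\|<\epsilon$ and there exists $\delta(\epsilon)>0$ such that for each $x_0\in S_{\mathbb{H}_1}$ with $\|Tx_0\|>1-\delta(\epsilon)$ there exists $u_0\in M_A$ with $\|u_0-x_0\|<\epsilon$. *)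

theory Defs
  imports "HOL-Analysis.Analysis"
begin

text \<open>
  The ambient spaces of the theorem: a finite-dimensional real Hilbert space is a type of class
  \<^class>\<open>euclidean_space\<close>; an arbitrary real Hilbert space is a type that is both
  \<^class>\<open>real_inner\<close> and \<^class>\<open>complete_space\<close>.
\<close>

definition norm_attainment_set ::
    "'a::real_normed_vector \<Rightarrow>\<^sub>L 'b::real_normed_vector \<Rightarrow> 'a set" where
  "norm_attainment_set A = {x \<in> sphere 0 1. norm (blinfun_apply A x) = norm A}"

definition approx_norm_attainment_set ::
    "'a::real_normed_vector \<Rightarrow>\<^sub>L 'b::real_normed_vector \<Rightarrow> real \<Rightarrow> 'a set" where
  "approx_norm_attainment_set A \<delta> =
    {x \<in> sphere 0 1. norm (blinfun_apply A x) > norm A - \<delta>}"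

text \<open>Used only for \<open>T\<close> of norm one, whence the threshold \<open>1 - \<delta>\<close>.\<close>

definition uniform_BPB_approximation ::
    "real \<Rightarrow> ('a::real_normed_vector \<Rightarrow>\<^sub>L 'b::real_normed_vector) \<Rightarrow> ('a \<Rightarrow>\<^sub>L 'b) \<Rightarrow> bool" where
  "uniform_BPB_approximation \<epsilon> T A \<longleftrightarrow>
    A \<in> sphere 0 1 \<and> norm (T - A) < \<epsilon> \<and>
    (\<exists>\<delta>>0. \<forall>x0 \<in> sphere 0 1. norm (blinfun_apply T x0) > 1 - \<delta> \<longrightarrow>
      (\<exists>u0 \<in> norm_attainment_set A. norm (u0 - x0) < \<epsilon>))"

text \<open>
  The operator norm of the restriction of \<open>A\<close> to a subspace \<open>V\<close>, written as
  \<^const>\<open>onorm\<close> is, with the supremum over \<open>V\<close> in place of the whole space.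
  Since \<open>0 \<in> V\<close> contributes the value \<open>0 / 0 = 0\<close>, the supremum is never over the empty set,
  and the norm of the restriction to the zero subspace is \<open>0\<close>.
\<close>

definition restriction_norm ::
    "'a::real_normed_vector \<Rightarrow>\<^sub>L 'b::real_normed_vector \<Rightarrow> 'a set \<Rightarrow> real" where
  "restriction_norm A V = (SUP x\<in>V. norm (blinfun_apply A x) / norm x)"

end

theory Submission imports Defs begin

text \<open>
  The set of all \<open>x\<close> with \<open>\<parallel>A x\<parallel> = \<parallel>A\<parallel> \<parallel>x\<parallel>\<close> is a subspace, by the parallelogram law. On the unit
  sphere of the orthogonal complement of \<open>H\<^sub>0\<close> the continuous function \<open>\<parallel>T x\<parallel>\<close> is at most \<open>1 - d\<close> for some
  \<open>d > 0\<close>, by compactness. If \<open>dim H > dim H\<^sub>0\<close>, a unit vector of \<open>H\<close> orthogonal to \<open>H\<^sub>0\<close> yields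
  \<open>\<parallel>T - A\<parallel> \<ge> d\<close>; if \<open>dim H < dim H\<^sub>0\<close>, a unit vector of \<open>H\<^sub>0\<close> orthogonal to \<open>H\<close> has distance
  \<open>\<surd>2\<close> from \<open>M\<^sub>A\<close>. Both are impossible once \<open>\<epsilon> < min 1 d\<close>. The restriction norms in (ii) are
  both at most \<open>\<parallel>T - A\<parallel> < \<epsilon>\<close>, and (iii) is part of the definition of uniform approximation.
\<close>

lemma parallelogram_law:
  fixes x y :: "'a::real_inner"
  shows "(norm (x + y))\<^sup>2 + (norm (x - y))\<^sup>2 = 2 * (norm x)\<^sup>2 + 2 * (norm y)\<^sup>2"
  by (simp add: power2_norm_eq_inner algebra_simps inner_commute)

text \<open>The homogeneous form of the condition defining M_A: it admits 0 and all scalar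
  multiples, so that it can serve as the subspace whose unit sphere is M_A.\<close>

definition norming_space :: "'a::real_normed_vector \<Rightarrow>\<^sub>L 'b::real_normed_vector \<Rightarrow> 'a set" where
  "norming_space A = {x. norm (blinfun_apply A x) = norm A * norm x}"

lemma subspace_norming_space:
  fixes A :: "'a::real_inner \<Rightarrow>\<^sub>L 'b::real_inner"
  shows "subspace (norming_space A)"
proof (rule subspaceI)
  fix x y assume x: "x \<in> norming_space A" and y: "y \<in> norming_space A"
  have le: "(norm (A z))\<^sup>2 \<le> (norm A)\<^sup>2 * (norm z)\<^sup>2" for z
    by (metis norm_blinfun norm_ge_zero power_mono power_mult_distrib)
  have "(norm (A (x + y)))\<^sup>2 + (norm (A (x - y)))\<^sup>2 = 2 * (norm (A x))\<^sup>2 + 2 * (norm (A y))\<^sup>2"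
    by (simp add: blinfun.add_right blinfun.diff_right parallelogram_law)
  also have "\<dots> = (norm A)\<^sup>2 * (2 * (norm x)\<^sup>2 + 2 * (norm y)\<^sup>2)"
    using x y by (simp add: norming_space_def power_mult_distrib algebra_simps)
  also have "\<dots> = (norm A)\<^sup>2 * (norm (x + y))\<^sup>2 + (norm A)\<^sup>2 * (norm (x - y))\<^sup>2"
    by (simp add: distrib_left flip: parallelogram_law)
  \<comment> \<open>The bounds \<open>le\<close> at \<open>x + y\<close> and \<open>x - y\<close>
    add up to an equality, so each of them is an equality.\<close>
  finally have "(norm (A (x + y)))\<^sup>2 = (norm A * norm (x + y))\<^sup>2"
    using le[of "x + y"] le[of "x - y"] by (simp add: power_mult_distrib)
  then show "x + y \<in> norming_space A"
    by (simp add: norming_space_def)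
qed (auto simp: norming_space_def blinfun.scaleR_right)

lemma norm_attainment_set_eq:
  "norm_attainment_set A = sphere 0 1 \<inter> norming_space A"
  by (auto simp: norm_attainment_set_def norming_space_def)

lemma restriction_norm_le_norm:
  assumes "V \<noteq> {}"
  shows "restriction_norm A V \<le> norm A"
  unfolding restriction_norm_def
proof (rule cSUP_least[OF assms])
  show "norm (A x) / norm x \<le> norm A" for x
    \<comment> \<open>At \<open>x = 0\<close> the quotient is 0 / 0 = 0.\<close>
    using norm_blinfun[of A x] by (cases "x = 0") (auto simp: divide_le_eq)
qed

text \<open>The orthogonal complement of \<open>U\<close> has codimension \<open>dim U\<close>, so
  it meets \<open>V\<close> in dimension at least \<open>dim V - dim U > 0\<close>.\<close>

lemma dim_less_imp_unit_vector_orthogonal: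
  fixes U V :: "'a::euclidean_space set"
  assumes "subspace U" "subspace V" "dim U < dim V"
  obtains x where "x \<in> V" "x \<in> orthogonal_comp U" "norm x = 1"
proof -
  have "dim U + dim (orthogonal_comp U) = DIM('a)"
    using dim_subspace_orthogonal_to_vectors[OF \<open>subspace U\<close> subspace_UNIV]
    by (simp add: orthogonal_comp_def)
  moreover have "dim {x + y |x y. x \<in> V \<and> y \<in> orthogonal_comp U} + dim (V \<inter> orthogonal_comp U)
      = dim V + dim (orthogonal_comp U)"
    by (intro dim_sums_Int subspace_orthogonal_comp assms)
  moreover have "dim {x + y |x y. x \<in> V \<and> y \<in> orthogonal_comp U} \<le> DIM('a)"
    by (rule dim_subset_UNIV)
  ultimately have "dim (V \<inter> orthogonal_comp U) \<noteq> 0"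
    using assms(3) by linarith
  then obtain z where z: "z \<in> V" "z \<in> orthogonal_comp U" "z \<noteq> 0"
    by auto
  show ?thesis
  proof
    show "z /\<^sub>R norm z \<in> V" "z /\<^sub>R norm z \<in> orthogonal_comp U"
      using z assms(2) by (auto intro: subspace_scale subspace_orthogonal_comp)
    show "norm (z /\<^sub>R norm z) = 1"
      using z by simp
  qed
qed

lemma norm_gap_on_orthogonal_comp:
  fixes T :: "'a::euclidean_space \<Rightarrow>\<^sub>L 'b::real_normed_vector"
  obtains d where "d > 0"
    and "\<And>x. \<lbrakk>x \<in> orthogonal_comp (norming_space T); norm x = 1\<rbrakk> \<Longrightarrow> norm (T x) \<le> norm T - d"
proof -
  define K where "K = sphere 0 1 \<inter> orthogonal_comp (norming_space T)"
  have "compact K"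
    unfolding K_def by (intro compact_Int_closed compact_sphere closed_subspace subspace_orthogonal_comp)
  show ?thesis
  proof (cases "K = {}")
    case True
    \<comment> \<open>The complement has no unit vector here, so any positive gap will do.\<close>
    then show ?thesis
      by (intro that[of 1]) (auto simp: K_def)
  next
    case False
    have "continuous_on K (\<lambda>x. norm (T x))"
      by (intro continuous_intros)
    from continuous_attains_sup[OF \<open>compact K\<close> False this]
    obtain m where m: "m \<in> K" "\<And>x. x \<in> K \<Longrightarrow> norm (T x) \<le> norm (T m)"
      by auto
    \<comment> \<open>Otherwise \<open>m\<close> would be orthogonal to itself, hence zero, but it
      has norm 1.\<close>
    have "m \<notin> norming_space T"
      using m(1) by (auto simp: K_def orthogonal_comp_def orthogonal_def)
    then have "norm (T m) < norm T"
      using m(1) norm_blinfun[of T m] by (auto simp: K_def norming_space_def)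
    then show ?thesis
      using m(2) by (intro that[of "norm T - norm (T m)"]) (auto simp: K_def)
  qed
qed

text \<open>Pythagoras makes the squared distance \<open>(norm u)\<^sup>2 + 1\<close>. For a unit
  vector \<open>u\<close> the distance is the square root of 2, but the bound 1 is enough against
  \<epsilon> < 1.\<close>

lemma norm_diff_orthogonal_ge_1:
  assumes "orthogonal u x" "norm x = 1"
  shows "norm (u - x) \<ge> 1"
proof -
  have "(norm (u - x))\<^sup>2 = (norm u)\<^sup>2 + (norm x)\<^sup>2"
    using norm_add_Pythagorean[of u "- x"] assms(1) by (simp add: orthogonal_clauses)
  then have "1\<^sup>2 \<le> (norm (u - x))\<^sup>2"
    using assms(2) by simp
  then show ?thesis
    by (rule power2_le_imp_le) simp
qed

theorem theorem5p7:
  fixes T :: "'a::euclidean_space \<Rightarrow>\<^sub>L 'b::{real_inner, complete_space}"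
  assumes "T \<in> sphere 0 1"
  shows "\<exists>\<epsilon>0>0. \<forall>\<epsilon>. 0 < \<epsilon> \<and> \<epsilon> < \<epsilon>0 \<longrightarrow>
    (\<forall>A. uniform_BPB_approximation \<epsilon> T A \<longrightarrow>
      (\<exists>H0 H. subspace H0 \<and> subspace H \<and>
        norm_attainment_set T = sphere 0 1 \<inter> H0 \<and>
        norm_attainment_set A = sphere 0 1 \<inter> H \<and>
        dim H0 = dim H \<and>
        (\<forall>\<epsilon>1>0. \<forall>\<epsilon>2>0. \<epsilon>1\<^sup>2 + \<epsilon>2\<^sup>2 > 2 * \<epsilon>\<^sup>2 \<longrightarrow>
          restriction_norm (T - A) H0 < \<epsilon>1 \<or>
          restriction_norm (T - A) (orthogonal_comp H0) < \<epsilon>2) \<and>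
        (\<exists>\<delta>>0. approx_norm_attainment_set T \<delta> \<subseteq>
          (\<Union>x \<in> norm_attainment_set A. ball x \<epsilon>))))"
proof -
  let ?M = "norming_space T"
  have norm_T: "norm T = 1"
    using assms by simp
  obtain d where "d > 0" and d: "\<And>x. \<lbrakk>x \<in> orthogonal_comp ?M; norm x = 1\<rbrakk> \<Longrightarrow> norm (T x) \<le> 1 - d"
    using norm_gap_on_orthogonal_comp[of T] norm_T by auto
  have main: "dim ?M = dim (norming_space A) \<and>
        (\<forall>\<epsilon>1>0. \<forall>\<epsilon>2>0. \<epsilon>1\<^sup>2 + \<epsilon>2\<^sup>2 > 2 * \<epsilon>\<^sup>2 \<longrightarrow>
          restriction_norm (T - A) ?M < \<epsilon>1 \<or>
          restriction_norm (T - A) (orthogonal_comp ?M) < \<epsilon>2) \<and>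
        (\<exists>\<delta>>0. approx_norm_attainment_set T \<delta> \<subseteq> (\<Union>x \<in> norm_attainment_set A. ball x \<epsilon>))"
    if "\<epsilon> < min 1 d" and bpb: "uniform_BPB_approximation \<epsilon> T A" for \<epsilon> A
  proof (intro conjI allI impI)
    let ?N = "norming_space A"
    have norm_A: "norm A = 1" and close: "norm (T - A) < \<epsilon>"
      using bpb by (auto simp: uniform_BPB_approximation_def)
    obtain \<delta> where "\<delta> > 0" and \<delta>: "\<And>x. \<lbrakk>norm x = 1; norm (T x) > 1 - \<delta>\<rbrakk> \<Longrightarrow>
        \<exists>u \<in> norm_attainment_set A. norm (u - x) < \<epsilon>"
      using bpb by (auto simp: uniform_BPB_approximation_def)
    have "\<not> dim ?M < dim ?N"
    proof
      assume "dim ?M < dim ?N"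
      then obtain x where x: "x \<in> ?N" "x \<in> orthogonal_comp ?M" "norm x = 1"
        by (rule dim_less_imp_unit_vector_orthogonal[OF subspace_norming_space subspace_norming_space])
      have "norm (A x) - norm (T x) \<le> norm ((T - A) x)"
        by (simp add: blinfun.diff_left norm_minus_commute norm_triangle_ineq2)
      moreover have "norm ((T - A) x) \<le> norm (T - A)"
        using norm_blinfun[of "T - A" x] x(3) by simp
      \<comment> \<open>Here \<open>norm (A x) = 1\<close> and
        \<open>norm (T x) \<le> 1 - d\<close>, whence d \<le> \<open>norm (T - A)\<close> <
        \<epsilon> < d.\<close>
      ultimately show False
        using d[OF x(2,3)] x norm_A close that(1) by (simp add: norming_space_def)
    qed
    moreover have "\<not> dim ?N < dim ?M"
    proof
      assume "dim ?N < dim ?M"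
      then obtain x where x: "x \<in> ?M" "x \<in> orthogonal_comp ?N" "norm x = 1"
        by (rule dim_less_imp_unit_vector_orthogonal[OF subspace_norming_space subspace_norming_space])
      \<comment> \<open>Since \<open>norm (T x) = 1\<close> exceeds 1 - \<delta>, the approximation
        property applies to \<open>x\<close>.\<close>
      then obtain u where u: "u \<in> norm_attainment_set A" "norm (u - x) < \<epsilon>"
        using \<delta>[of x] \<open>\<delta> > 0\<close> norm_T by (auto simp: norming_space_def)
      have "orthogonal u x"
        using u(1) x(2) by (auto simp: norm_attainment_set_eq orthogonal_comp_def)
      then show False
        using norm_diff_orthogonal_ge_1[of u x] x(3) u(2) that(1) by simp
    qed
    ultimately show "dim ?M = dim ?N"
      by simp
    show "restriction_norm (T - A) ?M < \<epsilon>1 \<or>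
        restriction_norm (T - A) (orthogonal_comp ?M) < \<epsilon>2"
      if "0 < \<epsilon>1" "0 < \<epsilon>2" "\<epsilon>1\<^sup>2 + \<epsilon>2\<^sup>2 > 2 * \<epsilon>\<^sup>2" for \<epsilon>1 \<epsilon>2
    proof (rule ccontr)
      assume "\<not> ?thesis"
      \<comment> \<open>The zero vector shows that both subspaces are nonempty, as the bound on the
        supremum requires.\<close>
      moreover have "restriction_norm (T - A) ?M \<le> norm (T - A)"
        "restriction_norm (T - A) (orthogonal_comp ?M) \<le> norm (T - A)"
        using subspace_0[OF subspace_norming_space] subspace_0[OF subspace_orthogonal_comp]
        by (auto intro!: restriction_norm_le_norm)
      ultimately have "\<epsilon>1 \<le> \<epsilon>" "\<epsilon>2 \<le> \<epsilon>"
        using close by auto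
      then have "\<epsilon>1\<^sup>2 \<le> \<epsilon>\<^sup>2" "\<epsilon>2\<^sup>2 \<le> \<epsilon>\<^sup>2"
        using that by (auto intro: power_mono)
      then show False
        using that(3) by simp
    qed
    show "\<exists>\<delta>>0. approx_norm_attainment_set T \<delta> \<subseteq> (\<Union>x \<in> norm_attainment_set A. ball x \<epsilon>)"
      \<comment> \<open>The \<delta> of the approximation property serves, because
        \<open>norm T = 1\<close> turns its threshold 1 - \<delta> into
        \<open>norm T - \<delta>\<close>.\<close>
      using \<open>\<delta> > 0\<close> \<delta> norm_T
      by (intro exI[of _ \<delta>]) (auto simp: approx_norm_attainment_set_def dist_norm)
  qed
  show ?thesis
  proof (intro exI[of _ "min 1 d"] conjI allI impI)
    show "min 1 d > 0"
      using \<open>d > 0\<close> by simp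
    show "\<exists>H0 H. subspace H0 \<and> subspace H \<and>
        norm_attainment_set T = sphere 0 1 \<inter> H0 \<and>
        norm_attainment_set A = sphere 0 1 \<inter> H \<and>
        dim H0 = dim H \<and>
        (\<forall>\<epsilon>1>0. \<forall>\<epsilon>2>0. \<epsilon>1\<^sup>2 + \<epsilon>2\<^sup>2 > 2 * \<epsilon>\<^sup>2 \<longrightarrow>
          restriction_norm (T - A) H0 < \<epsilon>1 \<or>
          restriction_norm (T - A) (orthogonal_comp H0) < \<epsilon>2) \<and>
        (\<exists>\<delta>>0. approx_norm_attainment_set T \<delta> \<subseteq> (\<Union>x \<in> norm_attainment_set A. ball x \<epsilon>))"
      if "0 < \<epsilon> \<and> \<epsilon> < min 1 d" "uniform_BPB_approximation \<epsilon> T A" for \<epsilon> A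
      \<comment> \<open>The witnesses for \<open>H0\<close> and \<open>H\<close> are the norming
        spaces of \<open>T\<close> and \<open>A\<close>.\<close>
      using main[of \<epsilon> A] that subspace_norming_space[of T] subspace_norming_space[of A]
        norm_attainment_set_eq[of T] norm_attainment_set_eq[of A]
      by blast
  qed
qed

end
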